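(* For every decorated tree $T$, $\phi_T(T)=\phi_I(\mathrm{I}(T))$; that is, $\phi_T=\phi_I\circ\mathrm{I}$.
   Context: $\beta$-(1,0) trees: rooted plane trees with at least one edge, a positive integer label on every node, leaves labeled $1$, root label equal to the sum of its children's labels, other internal nodes labeled between $1$ and the sum of their children's labels; $\operatorname{root}(B)$ is the root label; $B_0$ is the one-edge tree. $\Delta_{\mathcal B}(B,i)$ ($1\le i\le\operatorname{root}(B)$): attach the root of $B$ as only child of a new root, labeling both old and new root $i$. $\oplus_{\mathcal B}(B_1,i,B_2)$ ($1\le i\le\operatorname{root}(B_1)$): add the root of $B_1$ with its subtree, relabeled $i$, as new leftmost child of the root of $B_2$, and relabel the root $i+\operatorname{root}(B_2)$. $L(B)$: add a leaf as leftmost child of the root and increase the root label by $1$. Decorated trees: depth of the root is $0$, traversal order is preorder (left-to-right). A decorated tree is a rooted plane tree with at least one edge, each leaf labeled by an integer $\ge-1$, such that (1) each leaf label is strictly less than the depth of its parent; (2) every internal node of depth $p>0$ has a descendant leaf labeled $\le p-2$; (3) for every internal node $t$ of depth $p$, every subtree $T''$ rooted at a child of $t$ and every leaf $\ell$ of $T''$ labeled $p$, the leaves of $T''$ preceding $\ell$ have labels $\ge p$. Free leaves are labeled $-1$; $\operatorname{fl}(T)$ counts them. $\Pi_{\mathcal T}(T)$ (root with one child) deletes the root and subtracts $1$ from every non-free leaf label. $\phi_T$: root with a single leaf child: $B_0$; root with a single internal child: $\Delta_{\mathcal B}(\phi_T(\Pi_{\mathcal T}(T)),\operatorname{fl}(T))$;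 root with $\ge2$ children, leftmost a leaf: $L(\phi_T(T'))$ with $T'$ = $T$ without that leaf; root with $\ge2$ children, leftmost internal: with $T_{hd}$ = root + leftmost child + its subtree, $T_{tl}$ = root + other children + their subtrees, $\oplus_{\mathcal B}(\phi_T(\Pi_{\mathcal T}(T_{hd})),\operatorname{fl}(T_{hd}),\phi_T(T_{tl}))$. Dyck paths and synchronized intervals: a Dyck path of size $n$ is a word with $n$ letters $u$ and $n$ letters $d$ all of whose prefixes contain at least as many $u$ as $d$ (the empty path $\epsilon$ is the Dyck path of size $0$). A contact is a return of the path to height $0$; $c(D)$ denotes the number of non-initial contacts of $D$ ($c(\epsilon)=0$). The Tamari order on Dyck paths of size $n$ is the transitive closure of $VdD_1W\preceq VD_1dW$ for words $V,W$ and nonempty Dyck paths $D_1$. The type of a Dyck path of size $n$ is the word $w\in\{N,E\}^{n-1}$ with $w_k=E$ iff the $k$-th up step is immediately followed by an up step. A synchronized interval of order $n\ge1$ is a pair $[P,Q]$ of Dyck paths of size $n$ with $P\preceq Q$ and equal types; $\operatorname{cont}([P,Q])=c(P)$. Every nonempty Dyck path $Q$ is uniquely $uQ_1dQ_2$ with $Q_1,Q_2$ (possibly empty) Dyck paths. The map $\phi_I$ from synchronized intervals to $\beta$-(1,0) trees: write $Q=uQ_1dQ_2$ and $P=uP^\ell dR$ with $P^\ell$ a possibly empty Dyck path; let $R=P^rP_2$ with $P^r$ the prefix of $R$ such that $P^\ell P^r$ has the size of $Q_1$ (for synchronized intervals, $[P^\ell P^r,Q_1]$ and $[P_2,Q_2]$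 are synchronized intervals when nonempty). If $Q_1,Q_2$ are empty ($P=Q=ud$), $\phi_I=B_0$; if $Q_1\ne\epsilon=Q_2$, $\phi_I([P,Q])=\Delta_{\mathcal B}(\phi_I([P^\ell P^r,Q_1]),\operatorname{cont}([P,Q]))$; if $Q_1=\epsilon\ne Q_2$ (then $P=udP_2$), $\phi_I([P,Q])=L(\phi_I([P_2,Q_2]))$; if both nonempty, $\phi_I([P,Q])=\oplus_{\mathcal B}(\phi_I([P^\ell P^r,Q_1]),1+c(P^r),\phi_I([P_2,Q_2]))$. The map $\mathrm{I}$: for a non-root internal node $x$ of depth $p$ of a decorated tree, its certificate is the first leaf in traversal order among its descendants with label $\le p-2$; for a leaf $\ell$, $c(\ell)$ is the number of nodes having certificate $\ell$. In a left-to-right depth-first traversal, $\mathrm{Q}(T)$ records $u$ for each edge descended and $d$ for each edge ascended; $\mathrm{P}(T)$ records $u$ for each edge descended and $d^{c(\ell)+1}$ upon reaching each leaf $\ell$. $\mathrm{I}(T)=[\mathrm{P}(T),\mathrm{Q}(T)]$, a synchronized interval. *)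

theory Defs
  imports Main
begin

section \<open>Beta-(1,0) trees\<close>

datatype ltree = LNode (root: nat) (children: "ltree list")

text \<open>\<open>beta_sub\<close> is the labelling condition for a node other than the root and all its
  descendants.\<close>

fun beta_sub :: "ltree \<Rightarrow> bool" where
  "beta_sub (LNode r ts) \<longleftrightarrow>
     (if ts = [] then r = 1 else 1 \<le> r \<and> r \<le> sum_list (map root ts)) \<and>
     (\<forall>t \<in> set ts. beta_sub t)"

definition beta10 :: "ltree \<Rightarrow> bool" where
  "beta10 B \<longleftrightarrow> children B \<noteq> [] \<and> root B = sum_list (map root (children B)) \<and>
     (\<forall>t \<in> set (children B). beta_sub t)"

definition B0 :: ltree where
  "B0 = LNode 1 [LNode 1 []]"

text \<open>The two operations below are used for \<open>1 \<le> i \<le> root B\<close>; outside this range the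
  same formula is kept, but it need not produce a beta-(1,0) tree.\<close>

definition Delta_B :: "ltree \<Rightarrow> nat \<Rightarrow> ltree" where
  "Delta_B B i = LNode i [LNode i (children B)]"

definition oplus_B :: "ltree \<Rightarrow> nat \<Rightarrow> ltree \<Rightarrow> ltree" where
  "oplus_B B1 i B2 = LNode (i + root B2) (LNode i (children B1) # children B2)"

definition L_B :: "ltree \<Rightarrow> ltree" where
  "L_B B = LNode (root B + 1) (LNode 1 [] # children B)"

lemma beta10_B0: "beta10 B0"
  by (simp add: beta10_def B0_def)

lemma beta10_Delta_B: "beta10 B \<Longrightarrow> 1 \<le> i \<Longrightarrow> i \<le> root B \<Longrightarrow> beta10 (Delta_B B i)"
  by (simp add: beta10_def Delta_B_def)

lemma beta10_oplus_B:
  "beta10 B1 \<Longrightarrow> 1 \<le> i \<Longrightarrow> i \<le> root B1 \<Longrightarrow> beta10 B2 \<Longrightarrow> beta10 (oplus_B B1 i B2)"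
  by (simp add: beta10_def oplus_B_def)

lemma beta10_L_B: "beta10 B \<Longrightarrow> beta10 (L_B B)"
  by (simp add: beta10_def L_B_def)


section \<open>Decorated trees\<close>

text \<open>An internal node has at least one child; this is imposed in \<open>decorated\<close>.\<close>

datatype 'a ptree = is_Leaf: Leaf 'a | Node "'a ptree list"

fun leaves :: "'a ptree \<Rightarrow> 'a list" where
  "leaves (Leaf a) = [a]"
| "leaves (Node ts) = concat (map leaves ts)"

text \<open>Preorder list of the nodes of a tree.  A node is represented by \<open>(p, k, t)\<close>, where \<open>p\<close> is
  its depth, \<open>t\<close> the subtree rooted at it, and \<open>k\<close> the number of leaves preceding that subtree;
  thus the leaves below the node are those numbered \<open>k, \<dots>, k + length (leaves t) - 1\<close> in
  traversal order (counting from 0).\<close>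

fun nodes_from :: "nat \<Rightarrow> nat \<Rightarrow> 'a ptree \<Rightarrow> (nat \<times> nat \<times> 'a ptree) list"
  and nodes_from_list :: "nat \<Rightarrow> nat \<Rightarrow> 'a ptree list \<Rightarrow> (nat \<times> nat \<times> 'a ptree) list" where
  "nodes_from p k (Leaf a) = [(p, k, Leaf a)]"
| "nodes_from p k (Node ts) = (p, k, Node ts) # nodes_from_list (Suc p) k ts"
| "nodes_from_list p k [] = []"
| "nodes_from_list p k (t # ts) =
     nodes_from p k t @ nodes_from_list p (k + length (leaves t)) ts"

definition nodes :: "'a ptree \<Rightarrow> (nat \<times> nat \<times> 'a ptree) list" where
  "nodes T = nodes_from 0 0 T"

definition decorated :: "int ptree \<Rightarrow> bool" where
  "decorated T \<longleftrightarrow>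
     \<not> is_Leaf T \<and>
     (\<forall>a \<in> set (leaves T). -1 \<le> a) \<and>
     (\<forall>p k ts. (p, k, Node ts) \<in> set (nodes T) \<longrightarrow>
        ts \<noteq> [] \<and>
        (\<forall>a. Leaf a \<in> set ts \<longrightarrow> a < int p) \<and>
        (0 < p \<longrightarrow> (\<exists>a \<in> set (leaves (Node ts)). a \<le> int p - 2)) \<and>
        (\<forall>t \<in> set ts. \<forall>j < length (leaves t). leaves t ! j = int p \<longrightarrow>
           (\<forall>i < j. int p \<le> leaves t ! i)))"

definition fl :: "int ptree \<Rightarrow> nat" where
  "fl T = count_list (leaves T) (-1)"

definition decr_label :: "int \<Rightarrow> int" where
  "decr_label a = (if a = -1 then a else a - 1)"

text \<open>\<open>Pi_T\<close> is applied to trees whose root has exactly one child.\<close>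

fun Pi_T :: "int ptree \<Rightarrow> int ptree" where
  "Pi_T (Node [t]) = map_ptree decr_label t"
| "Pi_T _ = undefined"

lemma size_map_ptree: "size (map_ptree f t) = size t"
proof (induction t)
  case (Node ts)
  then show ?case by (simp add: size_list_conv_sum_list comp_def cong: map_cong)
qed simp

function (sequential) phi_T :: "int ptree \<Rightarrow> ltree" where
  "phi_T (Node [Leaf a]) = B0"
| "phi_T (Node [t]) = Delta_B (phi_T (Pi_T (Node [t]))) (fl (Node [t]))"
| "phi_T (Node (Leaf a # ts)) = L_B (phi_T (Node ts))"
| "phi_T (Node (t # ts)) =
     oplus_B (phi_T (Pi_T (Node [t]))) (fl (Node [t])) (phi_T (Node ts))"
| "phi_T _ = undefined"
  by pat_completeness auto
termination
  by (relation "measure size") (auto simp: size_map_ptree simp del: ptree.map)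


section \<open>Dyck paths and synchronized intervals\<close>

datatype step = Up | Down

definition height :: "step list \<Rightarrow> int" where
  "height w = int (count_list w Up) - int (count_list w Down)"

definition dyck :: "step list \<Rightarrow> bool" where
  "dyck w \<longleftrightarrow> height w = 0 \<and> (\<forall>k \<le> length w. 0 \<le> height (take k w))"

definition contacts :: "step list \<Rightarrow> nat" where
  "contacts w = card {k. 1 \<le> k \<and> k \<le> length w \<and> height (take k w) = 0}"

definition tamari_step :: "step list \<Rightarrow> step list \<Rightarrow> bool" where
  "tamari_step P Q \<longleftrightarrow> dyck P \<and> dyck Q \<and>
     (\<exists>V D1 W. dyck D1 \<and> D1 \<noteq> [] \<and> P = V @ [Down] @ D1 @ W \<and> Q = V @ D1 @ [Down] @ W)"

text \<open>The order is the reflexive transitive closure; a step itself is never trivial.\<close>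

definition tamari_le :: "step list \<Rightarrow> step list \<Rightarrow> bool" where
  "tamari_le = tamari_step\<^sup>*\<^sup>*"

datatype type_letter = TypN | TypE

fun up_letters :: "step list \<Rightarrow> type_letter list" where
  "up_letters [] = []"
| "up_letters (Down # w) = up_letters w"
| "up_letters (Up # w) = (if w \<noteq> [] \<and> hd w = Up then TypE else TypN) # up_letters w"

text \<open>The type has length \<open>n - 1\<close>: the last up step is not recorded.\<close>

definition dyck_type :: "step list \<Rightarrow> type_letter list" where
  "dyck_type w = butlast (up_letters w)"

type_synonym interval = "step list \<times> step list"

definition sync_interval :: "interval \<Rightarrow> bool" where
  "sync_interval = (\<lambda>(P, Q). dyck P \<and> dyck Q \<and> P \<noteq> [] \<and> length P = length Q \<and>
     tamari_le P Q \<and> dyck_type P = dyck_type Q)"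

definition cont :: "interval \<Rightarrow> nat" where
  "cont X = contacts (fst X)"

text \<open>The pair \<open>(Q1, Q2)\<close> such that \<open>Q = u Q1 d Q2\<close>.\<close>

definition first_return :: "step list \<Rightarrow> step list \<times> step list" where
  "first_return Q =
     (THE (Q1, Q2). dyck Q1 \<and> dyck Q2 \<and> Q = [Up] @ Q1 @ [Down] @ Q2)"

lemma height_simps [simp]:
  "height [] = 0" "height (Up # w) = height w + 1" "height (Down # w) = height w - 1"
  "height (v @ w) = height v + height w"
  by (simp_all add: height_def)

lemma first_return_unique:
  assumes "dyck A" "dyck A'" "[Up] @ A @ [Down] @ B = [Up] @ A' @ [Down] @ B'"
  shows "A = A' \<and> B = B'"
proof -
  have le: "length X' \<le> length X"
    if "dyck X" "dyck X'" "X @ [Down] @ Y = X' @ [Down] @ Y'" for X X' Y Y'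
  proof (rule ccontr)
    assume "\<not> length X' \<le> length X"
    then have len: "length X < length X'" by simp
    have "take (Suc (length X)) X' = take (Suc (length X)) (X' @ [Down] @ Y')"
      using len by simp
    also have "\<dots> = X @ [Down]"
      unfolding that(3)[symmetric] by simp
    finally have "height (take (Suc (length X)) X') = -1"
      using that(1) by (simp add: dyck_def)
    moreover have "0 \<le> height (take (Suc (length X)) X')"
      using that(2) len unfolding dyck_def by (meson Suc_leI)
    ultimately show False by simp
  qed
  have "length A = length A'"
    using le[of A A' B B'] le[of A' A B' B] assms by simp
  then show ?thesis using assms(3) by simp
qed

lemma first_return_exists:
  assumes "dyck Q" "Q \<noteq> []"
  shows "\<exists>A B. dyck A \<and> dyck B \<and> Q = [Up] @ A @ [Down] @ B"
proof -
  define n where "n = (LEAST n. 0 < n \<and> n \<le> length Q \<and> height (take n Q) = 0)"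
  have ex: "0 < length Q \<and> length Q \<le> length Q \<and> height (take (length Q) Q) = 0"
    using assms by (simp add: dyck_def)
  have n: "0 < n" "n \<le> length Q" "height (take n Q) = 0"
    using LeastI[of "\<lambda>n. 0 < n \<and> n \<le> length Q \<and> height (take n Q) = 0", OF ex]
    unfolding n_def by auto
  have nonneg: "0 \<le> height (take k Q)" if "k \<le> length Q" for k
    using assms(1) that by (simp add: dyck_def)
  have pos: "1 \<le> height (take k Q)" if "0 < k" "k < n" for k
  proof -
    have "height (take k Q) \<noteq> 0"
      using not_less_Least[of k "\<lambda>n. 0 < n \<and> n \<le> length Q \<and> height (take n Q) = 0"] that n(2)
      unfolding n_def[symmetric] by auto
    then show ?thesis using nonneg[of k] that n(2) by simp
  qed
  obtain s Q' where Q: "Q = s # Q'" using assms(2) by (cases Q) auto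
  have s: "s = Up" using nonneg[of 1] Q by (cases s) auto
  have "n \<noteq> 1" using n(3) Q s by auto
  then obtain m where m: "n = Suc (Suc m)" using n(1)
    by (metis One_nat_def gr0_implies_Suc not0_implies_Suc)
  have mlt: "m < length Q'" using n(2) m Q by simp
  have tk: "take n Q = Up # take m Q' @ [Q' ! m]"
    using m Q s mlt by (simp add: take_Suc_conv_app_nth)
  have h1: "0 \<le> height (take k Q')" if "k \<le> m" for k
    using pos[of "Suc k"] that m Q s by simp
  have nth: "Q' ! m = Down"
    using n(3) h1[of m] tk by (cases "Q' ! m") auto
  have hm: "height (take m Q') = 0" using n(3) tk nth by simp
  have dA: "dyck (take m Q')"
    using hm h1 mlt by (auto simp: dyck_def min_def)
  have split: "Q = [Up] @ take m Q' @ [Down] @ drop (Suc m) Q'"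
    unfolding Q s using arg_cong[OF id_take_nth_drop[OF mlt, unfolded nth], of "Cons Up"]
    by (simp only: append_Cons append_Nil)
  have dB: "dyck (drop (Suc m) Q')"
    unfolding dyck_def
  proof (intro conjI allI impI)
    have "height Q = height (drop (Suc m) Q')"
      by (subst split) (use hm in simp)
    then show "height (drop (Suc m) Q') = 0" using assms(1) by (simp add: dyck_def)
    fix k assume k: "k \<le> length (drop (Suc m) Q')"
    have "take (n + k) Q = take n Q @ take k (drop n Q)" by (rule take_add)
    moreover have "drop n Q = drop (Suc m) Q'" using m Q by simp
    ultimately have "height (take (n + k) Q) = height (take k (drop (Suc m) Q'))"
      using n(3) by simp
    then show "0 \<le> height (take k (drop (Suc m) Q'))"
      using nonneg[of "n + k"] k m Q mlt by simp
  qed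
  show ?thesis using split dA dB by blast
qed

lemma first_return_eq:
  assumes "dyck A" "dyck B"
  shows "first_return ([Up] @ A @ [Down] @ B) = (A, B)"
  unfolding first_return_def
proof (rule the_equality)
  show "case (A, B) of (Q1, Q2) \<Rightarrow>
      dyck Q1 \<and> dyck Q2 \<and> [Up] @ A @ [Down] @ B = [Up] @ Q1 @ [Down] @ Q2"
    using assms by simp
next
  fix X :: "step list \<times> step list"
  assume "case X of (Q1, Q2) \<Rightarrow>
      dyck Q1 \<and> dyck Q2 \<and> [Up] @ A @ [Down] @ B = [Up] @ Q1 @ [Down] @ Q2"
  moreover obtain A' B' where X: "X = (A', B')" by (cases X)
  ultimately have "dyck A'" "[Up] @ A @ [Down] @ B = [Up] @ A' @ [Down] @ B'" by simp_all
  from first_return_unique[OF assms(1) this] show "X = (A, B)" by (simp add: X)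
qed

lemma first_return_split:
  assumes "dyck Q" "Q \<noteq> []" "first_return Q = (A, B)"
  shows "dyck A" "dyck B" "Q = [Up] @ A @ [Down] @ B"
proof -
  obtain A' B' where Q: "dyck A'" "dyck B'" "Q = [Up] @ A' @ [Down] @ B'"
    using first_return_exists[OF assms(1,2)] by blast
  then have "A' = A" "B' = B" using first_return_eq[OF Q(1,2)] assms(3) by auto
  then show "dyck A" "dyck B" "Q = [Up] @ A @ [Down] @ B" using Q by auto
qed

lemma first_return_length:
  assumes "sync_interval (P, Q)" "(A, B) = first_return Q"
  shows "length A < length Q \<and> length B < length Q"
proof -
  have "dyck Q" "Q \<noteq> []" using assms(1) by (auto simp: sync_interval_def)
  from first_return_split(3)[OF this assms(2)[symmetric]] show ?thesis by simp
qed

text \<open>\<open>phi_I\<close> is only meaningful on synchronized intervals, so the recursion is guarded by this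
  condition at every call.  Since a Dyck path of size \<open>n\<close> has length \<open>2 n\<close>, the prefix \<open>Pr\<close> for
  which \<open>Pl @ Pr\<close> has the size of \<open>Q1\<close> has length \<open>length Q1 - length Pl\<close>.\<close>

function phi_I :: "interval \<Rightarrow> ltree" where
  "phi_I (P, Q) =
     (if sync_interval (P, Q) then
        let (Q1, Q2) = first_return Q;
            (Pl, R) = first_return P;
            m = length Q1 - length Pl;
            Pr = take m R;
            P2 = drop m R
        in if Q1 = [] \<and> Q2 = [] then B0
           else if Q2 = [] then Delta_B (phi_I (Pl @ Pr, Q1)) (cont (P, Q))
           else if Q1 = [] then L_B (phi_I (P2, Q2))
           else oplus_B (phi_I (Pl @ Pr, Q1)) (1 + contacts Pr) (phi_I (P2, Q2))
      else undefined)"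
  by pat_completeness auto
termination
proof (relation "measure (\<lambda>(P, Q). length Q)", goal_cases)
  case 1
  show ?case by simp
next
  case (2 P Q X Q1 Q2 Y Pl R m Pr P2)
  then show ?case using first_return_length[of P Q Q1 Q2] by simp
next
  case (3 P Q X Q1 Q2 Y Pl R m Pr P2)
  then show ?case using first_return_length[of P Q Q1 Q2] by simp
next
  case (4 P Q X Q1 Q2 Y Pl R m Pr P2)
  then show ?case using first_return_length[of P Q Q1 Q2] by simp
next
  case (5 P Q X Q1 Q2 Y Pl R m Pr P2)
  then show ?case using first_return_length[of P Q Q1 Q2] by simp
qed

declare phi_I.simps [simp del]


section \<open>The map from decorated trees to synchronized intervals\<close>

text \<open>The number (in traversal order, from 0) of the leaf which is the certificate of the
  node \<open>(p, k, t)\<close>.\<close>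

definition certificate :: "nat \<times> nat \<times> int ptree \<Rightarrow> nat" where
  "certificate = (\<lambda>(p, k, t). k + length (takeWhile (\<lambda>a. \<not> a \<le> int p - 2) (leaves t)))"

definition cert_count :: "int ptree \<Rightarrow> nat \<Rightarrow> nat" where
  "cert_count T l =
     length (filter (\<lambda>(p, k, t). 0 < p \<and> \<not> is_Leaf t \<and> certificate (p, k, t) = l) (nodes T))"

fun Q_path :: "'a ptree \<Rightarrow> step list" where
  "Q_path (Leaf a) = []"
| "Q_path (Node ts) = concat (map (\<lambda>t. [Up] @ Q_path t @ [Down]) ts)"

text \<open>The traversal of a subtree that is preceded by \<open>k\<close> leaves, where \<open>c l\<close> is the number of
  nodes having leaf number \<open>l\<close> as certificate.\<close>

fun P_from :: "(nat \<Rightarrow> nat) \<Rightarrow> nat \<Rightarrow> 'a ptree \<Rightarrow> step list"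
  and P_from_list :: "(nat \<Rightarrow> nat) \<Rightarrow> nat \<Rightarrow> 'a ptree list \<Rightarrow> step list" where
  "P_from c k (Leaf a) = replicate (c k + 1) Down"
| "P_from c k (Node ts) = P_from_list c k ts"
| "P_from_list c k [] = []"
| "P_from_list c k (t # ts) =
     [Up] @ P_from c k t @ P_from_list c (k + length (leaves t)) ts"

definition P_path :: "int ptree \<Rightarrow> step list" where
  "P_path T = P_from (cert_count T) 0 T"

definition I_map :: "int ptree \<Rightarrow> interval" where
  "I_map T = (P_path T, Q_path T)"

end

theory Submission
  imports Defs
begin

text \<open>Both maps recurse on the leftmost child \<open>t\<close> of the root. The path \<open>P\<close> of a decorated tree is the
  concatenation of the paths of the trees obtained by keeping a single child of the root. If \<open>t\<close> is
  internal, deleting the root only loses the certificate of \<open>t\<close>, the first free leaf; so if the path of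
  the reduced tree is cut at that leaf into \<open>A\<close> and \<open>B\<close>, the path of the original tree is \<open>u A d B\<close>.
  Inductively, contacts occur exactly at free leaves, so \<open>A\<close> and \<open>B\<close> are Dyck paths and \<open>1 + c(B)\<close>
  counts the free leaves: this is the decomposition used by \<open>\<phi>\<^sub>I\<close>. The interval is synchronized since
  \<open>u A d B\<close> is below \<open>u A B d\<close>.\<close>


section \<open>Dyck paths\<close>

lemma dyck_Nil [simp]: "dyck []"
  by (simp add: dyck_def)

lemma dyck_append:
  assumes "dyck v" "dyck w"
  shows "dyck (v @ w)"
  unfolding dyck_def
proof (intro conjI allI impI)
  show "height (v @ w) = 0" using assms by (simp add: dyck_def)
  fix k assume "k \<le> length (v @ w)"
  then show "0 \<le> height (take k (v @ w))"
    using assms by (cases "k \<le> length v") (auto simp: dyck_def)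
qed

lemma dyck_Up_Down:
  assumes "dyck D"
  shows "dyck (Up # D @ [Down])"
  unfolding dyck_def
proof (intro conjI allI impI)
  show "height (Up # D @ [Down]) = 0"
    using assms by (simp add: dyck_def)
  fix k assume "k \<le> length (Up # D @ [Down])"
  then have "k = 0 \<or> (\<exists>j \<le> length D. k = Suc j) \<or> k = Suc (Suc (length D))"
    by (cases k) (auto simp: le_Suc_eq)
  then show "0 \<le> height (take k (Up # D @ [Down]))"
    using assms by (auto simp: dyck_def)
qed

lemma dyck_nonempty:
  assumes "dyck w" "w \<noteq> []"
  shows "hd w = Up" "last w = Down"
proof -
  obtain a v where w: "w = a # v" using assms(2) by (cases w) auto
  have "0 \<le> height (take 1 w)"
    using assms w unfolding dyck_def by (metis length_Cons le_add1 plus_1_eq_Suc)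
  then show "hd w = Up" using w by (cases a) auto
  obtain b u where w': "w = u @ [b]" using assms(2) by (cases w rule: rev_cases) auto
  have "0 \<le> height (take (length u) w)"
    using assms w' unfolding dyck_def by (metis le_add1 length_append)
  moreover have "height w = 0" using assms(1) by (simp add: dyck_def)
  ultimately show "last w = Down" using w' by (cases b) auto
qed

text \<open>The word \<open>w\<close> is read from height 0, so its contacts reappear in
  \<open>v @ w\<close> shifted by \<open>length v\<close>.\<close>

lemma contacts_append:
  assumes "dyck v"
  shows "contacts (v @ w) = contacts v + contacts w"
proof -
  let ?S = "\<lambda>w. {k. 1 \<le> k \<and> k \<le> length w \<and> height (take k w) = 0}"
  have hv: "height v = 0" using assms by (simp add: dyck_def)
  have "?S (v @ w) = ?S v \<union> (\<lambda>k. length v + k) ` ?S w"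
  proof (intro set_eqI iffI)
    fix k assume k: "k \<in> ?S (v @ w)"
    show "k \<in> ?S v \<union> (\<lambda>k. length v + k) ` ?S w"
    proof (cases "k \<le> length v")
      case False
      then have "k = length v + (k - length v)" "k - length v \<in> ?S w"
        using k hv by auto
      then show ?thesis by blast
    qed (use k in auto)
  qed (use hv in auto)
  moreover have "card (\<dots>) = card (?S v) + card ((\<lambda>k. length v + k) ` ?S w)"
    by (intro card_Un_disjoint) auto
  moreover have "card ((\<lambda>k. length v + k) ` ?S w) = card (?S w)"
    by (intro card_image) auto
  ultimately show ?thesis by (simp add: contacts_def)
qed

lemma contacts_Nil [simp]: "contacts [] = 0"
  by (auto simp: contacts_def)

lemma contacts_Up_Down:
  assumes "dyck D"
  shows "contacts (Up # D @ [Down]) = 1"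
proof -
  have "{k. 1 \<le> k \<and> k \<le> length (Up # D @ [Down]) \<and> height (take k (Up # D @ [Down])) = 0}
    = {Suc (Suc (length D))}"
  proof (intro set_eqI iffI)
    fix k
    assume k: "k \<in> {k. 1 \<le> k \<and> k \<le> length (Up # D @ [Down]) \<and>
      height (take k (Up # D @ [Down])) = 0}"
    then obtain j where j: "k = Suc j" "j \<le> Suc (length D)" by (cases k) auto
    have "\<not> j \<le> length D"
    proof
      assume le: "j \<le> length D"
      then have "height (take j D) = -1" using k j by simp
      moreover have "0 \<le> height (take j D)" using assms le by (simp add: dyck_def)
      ultimately show False by simp
    qed
    then show "k \<in> {Suc (Suc (length D))}" using j by simp
  qed (use assms in \<open>auto simp: dyck_def\<close>)
  then show ?thesis by (simp add: contacts_def)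
qed

text \<open>The letter of an up step depends only on the step after it; when \<open>v\<close> ends
  with a down step, no up step of \<open>v\<close> looks across the cut.\<close>

lemma up_letters_append:
  "v = [] \<or> last v = Down \<Longrightarrow> up_letters (v @ w) = up_letters v @ up_letters w"
  by (induction v rule: up_letters.induct) (auto split: if_splits)

lemma up_letters_dyck_append:
  "dyck v \<Longrightarrow> up_letters (v @ w) = up_letters v @ up_letters w"
  using dyck_nonempty up_letters_append by blast

text \<open>Since \<open>A\<close> begins with an up step, the leading up step gets
  \<open>TypE\<close>; since \<open>A\<close> ends with a down step, removing the
  \<open>Down\<close> after it changes no letter. Both paths of an interval are read this way, with
  \<open>B\<close> empty for the upper one.\<close>

lemma up_letters_Up_dyck:
  assumes "dyck A" "A \<noteq> []"
  shows "up_letters (Up # A @ Down # B) = TypE # up_letters (A @ B)"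
  using dyck_nonempty[OF assms] assms by (simp add: up_letters_dyck_append)

section \<open>The Tamari order under concatenation and elevation\<close>

lemma tamari_le_refl: "tamari_le w w"
  by (simp add: tamari_le_def)

lemma tamari_le_trans: "tamari_le u v \<Longrightarrow> tamari_le v w \<Longrightarrow> tamari_le u w"
  by (simp add: tamari_le_def)

text \<open>A single step inside a context is again a single step: \<open>X\<close> is absorbed into
  the prefix \<open>V\<close> and \<open>Y\<close> into the suffix \<open>W\<close>. The assumption
  on \<open>X\<close> and \<open>Y\<close> keeps all intermediate words Dyck paths.\<close>

lemma tamari_le_context:
  assumes "tamari_le P Q" "\<And>D. dyck D \<Longrightarrow> dyck (X @ D @ Y)"
  shows "tamari_le (X @ P @ Y) (X @ Q @ Y)"
  using assms(1) unfolding tamari_le_def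
proof (induction rule: rtranclp_induct)
  case (step Q R)
  then obtain V D1 W where QR: "dyck Q" "dyck R" "dyck D1" "D1 \<noteq> []"
    "Q = V @ [Down] @ D1 @ W" "R = V @ D1 @ [Down] @ W"
    unfolding tamari_step_def by auto
  have "X @ Q @ Y = (X @ V) @ [Down] @ D1 @ (W @ Y)" "X @ R @ Y = (X @ V) @ D1 @ [Down] @ (W @ Y)"
    by (simp_all add: QR(5,6))
  then have "tamari_step (X @ Q @ Y) (X @ R @ Y)"
    using assms(2) QR(1-4) unfolding tamari_step_def by blast
  then show ?case using step.IH by simp
qed simp

lemma tamari_le_append:
  assumes "tamari_le P Q" "tamari_le P' Q'" "dyck P'" "dyck Q"
  shows "tamari_le (P @ P') (Q @ Q')"
  using tamari_le_context[OF assms(1), of "[]" P'] tamari_le_context[OF assms(2), of Q "[]"]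
    assms(3,4) by (auto simp: dyck_append intro: tamari_le_trans)

text \<open>With \<open>D1 = B\<close> and \<open>W\<close> empty, one Tamari step moves the down
  step after \<open>A\<close> to the end; the rest happens inside the elevated path.\<close>

lemma tamari_le_Up_Down:
  assumes "dyck A" "dyck B" "tamari_le (A @ B) Q"
  shows "tamari_le (Up # A @ Down # B) (Up # Q @ [Down])"
proof (rule tamari_le_trans)
  show "tamari_le (Up # A @ Down # B) (Up # (A @ B) @ [Down])"
  proof (cases "B = []")
    case False
    have "tamari_step (Up # A @ Down # B) (Up # (A @ B) @ [Down])"
      unfolding tamari_step_def
    proof (intro conjI exI)
      show "dyck (Up # A @ Down # B)"
        using dyck_append[OF dyck_Up_Down[OF assms(1)] assms(2)] by simp
      show "dyck (Up # (A @ B) @ [Down])"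
        by (intro dyck_Up_Down dyck_append assms)
      show "Up # A @ Down # B = (Up # A) @ [Down] @ B @ []" by simp
      show "Up # (A @ B) @ [Down] = (Up # A) @ B @ [Down] @ []" by simp
    qed (use False assms in auto)
    then show ?thesis by (simp add: tamari_le_def)
  qed (simp add: tamari_le_refl)
  show "tamari_le (Up # (A @ B) @ [Down]) (Up # Q @ [Down])"
    using tamari_le_context[OF assms(3), of "[Up]" "[Down]"] dyck_Up_Down by simp
qed


section \<open>Decorated trees\<close>

definition decorated_node :: "nat \<Rightarrow> int ptree list \<Rightarrow> bool" where
  "decorated_node p ts \<longleftrightarrow>
     ts \<noteq> [] \<and>
     (\<forall>a. Leaf a \<in> set ts \<longrightarrow> a < int p) \<and>
     (0 < p \<longrightarrow> (\<exists>a \<in> set (leaves (Node ts)). a \<le> int p - 2)) \<and>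
     (\<forall>t \<in> set ts. \<forall>j < length (leaves t). leaves t ! j = int p \<longrightarrow>
        (\<forall>i < j. int p \<le> leaves t ! i))"

text \<open>The quantification over \<open>nodes\<close> becomes a recursion that carries the depth,
  so that subtrees can be treated by induction.\<close>

fun decorated_at :: "nat \<Rightarrow> int ptree \<Rightarrow> bool" where
  "decorated_at p (Leaf a) \<longleftrightarrow> True"
| "decorated_at p (Node ts) \<longleftrightarrow> decorated_node p ts \<and> (\<forall>t \<in> set ts. decorated_at (Suc p) t)"

lemma decorated_at_nodes:
  "(\<forall>q j ts. (q, j, Node ts) \<in> set (nodes_from p k t) \<longrightarrow> decorated_node q ts)
     \<longleftrightarrow> decorated_at p t"
  "(\<forall>q j ts. (q, j, Node ts) \<in> set (nodes_from_list p k us) \<longrightarrow> decorated_node q ts)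
     \<longleftrightarrow> (\<forall>t \<in> set us. decorated_at p t)"
proof (induction p k t and p k us rule: nodes_from_nodes_from_list.induct)
  case (4 p k t ts)
  then show ?case by (simp add: imp_disjL all_conj_distrib del: decorated_at.simps)
qed (auto simp del: split_paired_All)

lemma decorated_iff:
  "decorated T \<longleftrightarrow> \<not> is_Leaf T \<and> (\<forall>a \<in> set (leaves T). -1 \<le> a) \<and> decorated_at 0 T"
  unfolding decorated_def decorated_at_nodes(1)[of 0 0 T, symmetric] nodes_def decorated_node_def
  by blast

text \<open>At the root condition (2) is void and the other conditions concern each child
  separately, so children may be dropped as long as one remains.\<close>

lemma decorated_tail:
  "decorated (Node (t # ts)) \<Longrightarrow> ts \<noteq> [] \<Longrightarrow> decorated (Node ts)"
  by (auto simp: decorated_iff decorated_node_def)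

lemma decorated_head:
  "decorated (Node (t # ts)) \<Longrightarrow> decorated (Node [t])"
  by (auto simp: decorated_iff decorated_node_def)

lemma leaves_map_ptree: "leaves (map_ptree f t) = map f (leaves t)"
  by (induction t) (simp_all add: map_concat comp_def cong: map_cong)

text \<open>Depths and non-free labels drop by one together, which preserves the comparisons between
  them; only the labels -1, which stay, need care.\<close>

lemma decorated_node_decr:
  assumes "decorated_node (Suc p) ts" "\<forall>a \<in> set (leaves (Node ts)). -1 \<le> a"
  shows "decorated_node p (map (map_ptree decr_label) ts)"
  unfolding decorated_node_def
proof (intro conjI impI allI ballI)
  show "map (map_ptree decr_label) ts \<noteq> []"
    using assms(1) by (simp add: decorated_node_def)
next
  fix a assume "Leaf a \<in> set (map (map_ptree decr_label) ts)"
  then obtain t where t: "t \<in> set ts" "Leaf a = map_ptree decr_label t" by auto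
  obtain b where b: "t = Leaf b" "a = decr_label b" using t(2) by (cases t) auto
  then have "b < int (Suc p)"
    using t(1) assms(1) by (auto simp: decorated_node_def)
  with b show "a < int p" by (auto simp: decr_label_def)
next
  assume p: "0 < p"
  obtain a where "a \<in> set (leaves (Node ts))" "a \<le> int (Suc p) - 2"
    using assms(1) by (auto simp: decorated_node_def)
  moreover from this have "decr_label a \<le> int p - 2"
    using p by (auto simp: decr_label_def)
  ultimately show "\<exists>a\<in>set (leaves (Node (map (map_ptree decr_label) ts))). a \<le> int p - 2"
    by (auto simp: leaves_map_ptree)
next
  fix t' j i
  assume t': "t' \<in> set (map (map_ptree decr_label) ts)" and
    j: "j < length (leaves t')" "leaves t' ! j = int p" and i: "i < j"
  obtain t where t: "t \<in> set ts" "t' = map_ptree decr_label t" using t' by auto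
  \<comment> \<open>As \<open>p\<close> is nonnegative, a label \<open>p\<close> cannot be an
    unchanged -1, so it was \<open>Suc p\<close>.\<close>
  have "leaves t ! j = int (Suc p)"
    using j t by (auto simp: leaves_map_ptree decr_label_def split: if_splits)
  then have "int (Suc p) \<le> leaves t ! i"
    using assms(1) t j i unfolding decorated_node_def by (simp add: leaves_map_ptree)
  then show "int p \<le> leaves t' ! i"
    using i j t by (auto simp: leaves_map_ptree decr_label_def)
qed

lemma decorated_at_decr:
  assumes "decorated_at (Suc p) t" "\<forall>a \<in> set (leaves t). -1 \<le> a"
  shows "decorated_at p (map_ptree decr_label t)"
  using assms
proof (induction t arbitrary: p)
  case (Node ts)
  then show ?case by (auto intro!: decorated_node_decr)
qed simp

lemma decorated_Pi_T:
  assumes "decorated (Node [t])" "\<not> is_Leaf t"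
  shows "decorated (map_ptree decr_label t)"
  using assms decorated_at_decr[of 0 t]
  by (auto simp: decorated_iff leaves_map_ptree decr_label_def ptree.map_disc_iff)


section \<open>Certificates\<close>

text \<open>The version of \<open>cert_count\<close> for a subtree at depth \<open>p\<close>
  preceded by \<open>k\<close> leaves; leaves keep their numbers in the whole tree.\<close>

definition cert_from :: "nat \<Rightarrow> nat \<Rightarrow> int ptree \<Rightarrow> nat \<Rightarrow> nat" where
  "cert_from p k t l =
     length (filter (\<lambda>(p, k, t). 0 < p \<and> \<not> is_Leaf t \<and> certificate (p, k, t) = l)
       (nodes_from p k t))"

definition cert_from_list :: "nat \<Rightarrow> nat \<Rightarrow> int ptree list \<Rightarrow> nat \<Rightarrow> nat" where
  "cert_from_list p k ts l =
     length (filter (\<lambda>(p, k, t). 0 < p \<and> \<not> is_Leaf t \<and> certificate (p, k, t) = l)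
       (nodes_from_list p k ts))"

lemma cert_from_simps [simp]:
  "cert_from p k (Leaf a) l = 0"
  "cert_from p k (Node ts) l =
     (if 0 < p \<and> certificate (p, k, Node ts) = l then 1 else 0) + cert_from_list (Suc p) k ts l"
  "cert_from_list p k [] l = 0"
  "cert_from_list p k (t # ts) l =
     cert_from p k t l + cert_from_list p (k + length (leaves t)) ts l"
  by (simp_all add: cert_from_def cert_from_list_def)

lemma cert_count_Node: "cert_count (Node ts) l = cert_from_list 1 0 ts l"
  by (simp add: cert_count_def nodes_def cert_from_list_def)

lemma certificate_less:
  assumes "\<exists>a \<in> set (leaves t). a \<le> int p - 2"
  shows "certificate (p, k, t) < k + length (leaves t)"
proof -
  have "length (takeWhile (\<lambda>a. \<not> a \<le> int p - 2) (leaves t)) \<noteq> length (leaves t)"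
    using assms by (metis takeWhile_eq_take take_all_iff takeWhile_eq_all_conv order_refl)
  then show ?thesis
    using length_takeWhile_le[of "\<lambda>a. \<not> a \<le> int p - 2" "leaves t"]
    by (auto simp: certificate_def)
qed

text \<open>By condition (2) a node is certified by a leaf below it, so a subtree contributes only
  to its own leaves. This makes the counts of sibling subtrees independent.\<close>

lemma cert_from_support:
  "decorated_at p t \<Longrightarrow> cert_from p k t l \<noteq> 0 \<Longrightarrow> k \<le> l \<and> l < k + length (leaves t)"
  "\<forall>t \<in> set ts. decorated_at p t \<Longrightarrow> cert_from_list p k ts l \<noteq> 0 \<Longrightarrow>
     k \<le> l \<and> l < k + length (leaves (Node ts))"
proof (induction p k t and p k ts rule: nodes_from_nodes_from_list.induct)
  case (2 p k ts)
  have "k \<le> certificate (p, k, Node ts)" by (simp add: certificate_def)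
  moreover have "0 < p \<Longrightarrow> certificate (p, k, Node ts) < k + length (leaves (Node ts))"
    using 2(2) by (intro certificate_less) (simp add: decorated_node_def)
  ultimately show ?case using 2 by (auto split: if_splits)
next
  case (4 p k t ts)
  then show ?case by fastforce
qed auto

lemma cert_from_shift:
  "cert_from p (k + m) t (l + m) = cert_from p k t l"
  "cert_from_list p (k + m) ts (l + m) = cert_from_list p k ts l"
proof (induction p k t and p k ts rule: nodes_from_nodes_from_list.induct)
  case (4 p k t ts)
  then show ?case by (simp add: ac_simps)
qed (auto simp: certificate_def)

text \<open>A non-free label and the threshold drop by one together, while -1 exceeds neither
  threshold because \<open>p\<close> is positive.\<close>

lemma certificate_decr:
  assumes "0 < p" "\<forall>a \<in> set (leaves t). -1 \<le> a"
  shows "certificate (Suc p, k, t) = certificate (p, k, map_ptree decr_label t)"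
proof -
  have "takeWhile (\<lambda>a. \<not> a \<le> int (Suc p) - 2) (leaves t)
    = takeWhile ((\<lambda>a. \<not> a \<le> int p - 2) \<circ> decr_label) (leaves t)"
    using assms by (intro takeWhile_cong) (auto simp: decr_label_def)
  then show ?thesis
    by (simp add: certificate_def leaves_map_ptree takeWhile_map)
qed

lemma cert_from_decr:
  "0 < p \<Longrightarrow> \<forall>a \<in> set (leaves t). -1 \<le> a \<Longrightarrow>
     cert_from (Suc p) k t l = cert_from p k (map_ptree decr_label t) l"
  "0 < p \<Longrightarrow> \<forall>t \<in> set ts. \<forall>a \<in> set (leaves t). -1 \<le> a \<Longrightarrow>
     cert_from_list (Suc p) k ts l = cert_from_list p k (map (map_ptree decr_label) ts) l"
proof (induction p k t and p k ts rule: nodes_from_nodes_from_list.induct)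
  case (2 p k ts)
  then show ?case using certificate_decr[of p "Node ts" k] by simp
qed (auto simp: leaves_map_ptree)

text \<open>Once the root is deleted, \<open>t\<close> is a root and has no certificate, while the
  nodes below it keep theirs. At depth 1 the threshold is -1, so the lost certificate is the first
  free leaf.\<close>

lemma cert_from_root_child:
  assumes "\<forall>a \<in> set (leaves t). -1 \<le> a" "\<not> is_Leaf t"
  shows "cert_from 1 0 t l = cert_count (map_ptree decr_label t) l +
    (if l = length (takeWhile (\<lambda>a. a \<noteq> -1) (leaves t)) then 1 else 0)"
proof -
  obtain ts where t: "t = Node ts" using assms(2) by (cases t) auto
  have "takeWhile (\<lambda>a. \<not> a \<le> int 1 - 2) (leaves t) = takeWhile (\<lambda>a. a \<noteq> -1) (leaves t)"
    using assms(1) by (intro takeWhile_cong) auto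
  then have "certificate (1, 0, t) = length (takeWhile (\<lambda>a. a \<noteq> -1) (leaves t))"
    by (simp add: certificate_def)
  then show ?thesis
    using assms(1) cert_from_decr(2)[of 1 ts 0 l] by (auto simp: t cert_count_Node)
qed


section \<open>Blocks\<close>

text \<open>The path \<open>P\<close> is cut after the down steps produced at each leaf. \<open>leaf_ups\<close> lists, for
  each leaf, its label and the number of up steps directly before it; \<open>blocks\<close> replaces
  the label by the information whether the leaf is free.\<close>

fun add_up :: "('a \<times> nat) list \<Rightarrow> ('a \<times> nat) list" where
  "add_up [] = []"
| "add_up ((a, n) # xs) = (a, Suc n) # xs"

fun leaf_ups :: "'a ptree \<Rightarrow> ('a \<times> nat) list" where
  "leaf_ups (Leaf a) = [(a, 0)]"
| "leaf_ups (Node ts) = concat (map (\<lambda>t. add_up (leaf_ups t)) ts)"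

fun blocks :: "(nat \<Rightarrow> nat) \<Rightarrow> nat \<Rightarrow> (int \<times> nat) list \<Rightarrow> (bool \<times> step list) list" where
  "blocks c k [] = []"
| "blocks c k ((a, n) # xs) =
     (a = -1, replicate n Up @ replicate (Suc (c k)) Down) # blocks c (Suc k) xs"

definition word :: "(bool \<times> step list) list \<Rightarrow> step list" where
  "word zs = concat (map snd zs)"

lemma word_simps [simp]:
  "word [] = []" "word (z # zs) = snd z @ word zs" "word (zs @ zs') = word zs @ word zs'"
  by (simp_all add: word_def)

lemma map_fst_add_up: "map fst (add_up xs) = map fst xs"
  by (cases xs rule: add_up.cases) auto

lemma map_fst_leaf_ups: "map fst (leaf_ups t) = leaves t"
  by (induction t) (simp_all add: map_concat map_fst_add_up comp_def cong: map_cong)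

lemma length_leaf_ups: "length (leaf_ups t) = length (leaves t)"
  by (metis length_map map_fst_leaf_ups)

lemma length_add_up: "length (add_up xs) = length xs"
  by (metis length_map map_fst_add_up)

lemma add_up_map: "add_up (map (apfst f) xs) = map (apfst f) (add_up xs)"
  by (cases xs rule: add_up.cases) auto

lemma leaf_ups_map_ptree: "leaf_ups (map_ptree f t) = map (apfst f) (leaf_ups t)"
  by (induction t) (simp_all add: add_up_map map_concat comp_def cong: map_cong)

lemma leaves_nonempty: "decorated_at p t \<Longrightarrow> leaves t \<noteq> []"
  by (induction t arbitrary: p) (auto simp: decorated_node_def neq_Nil_conv)

lemma leaf_ups_nonempty: "decorated_at p t \<Longrightarrow> leaf_ups t \<noteq> []"
  using leaves_nonempty length_leaf_ups by (metis length_0_conv)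

lemma blocks_append:
  "blocks c k (xs @ ys) = blocks c k xs @ blocks c (k + length xs) ys"
  by (induction c k xs rule: blocks.induct) auto

text \<open>The two offsets allow a subtree to be compared under the leaf numbering of the whole
  tree and under its own.\<close>

lemma blocks_cong:
  "(\<And>i. i < length xs \<Longrightarrow> c (k + i) = c' (k' + i)) \<Longrightarrow> blocks c k xs = blocks c' k' xs"
proof (induction c k xs arbitrary: k' rule: blocks.induct)
  case (2 c k a n xs)
  have "c k = c' k'" using 2(2)[of 0] by simp
  moreover have "blocks c (Suc k) xs = blocks c' (Suc k') xs"
    using 2(2)[of "Suc i" for i] by (intro 2(1)) simp
  ultimately show ?case by simp
qed simp

lemma word_blocks_add_up:
  "xs \<noteq> [] \<Longrightarrow> word (blocks c k (add_up xs)) = Up # word (blocks c k xs)"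
  by (cases xs rule: add_up.cases) auto

lemma word_blocks_map:
  "word (blocks c k (map (apfst f) xs)) = word (blocks c k xs)"
  by (induction c k xs rule: blocks.induct) auto

text \<open>In a decorated tree every subtree has a leaf, so the up step of each edge can be charged
  to the first leaf below that edge.\<close>

lemma P_from_blocks:
  "decorated_at p t \<Longrightarrow> P_from c k t = word (blocks c k (leaf_ups t))"
  "\<forall>t \<in> set ts. decorated_at p t \<Longrightarrow> P_from_list c k ts = word (blocks c k (leaf_ups (Node ts)))"
proof (induction c k t and c k ts arbitrary: p and p rule: P_from_P_from_list.induct)
  case (2 c k ts)
  then show ?case using "2.IH"[of "Suc p"] by simp
next
  case (4 c k t ts)
  have "leaf_ups t \<noteq> []" using 4 leaf_ups_nonempty by auto
  then show ?case
    using "4.IH"(1)[of p] "4.IH"(2)[of p] "4.prems"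
    by (simp add: blocks_append word_blocks_add_up length_leaf_ups length_add_up)
qed auto

definition tree_blocks :: "int ptree \<Rightarrow> (bool \<times> step list) list" where
  "tree_blocks T = blocks (cert_count T) 0 (leaf_ups T)"

lemma P_path_blocks: "decorated T \<Longrightarrow> P_path T = word (tree_blocks T)"
  using P_from_blocks(1) by (auto simp: P_path_def tree_blocks_def decorated_iff)

lemma tree_blocks_Nil [simp]: "tree_blocks (Node []) = []"
  by (simp add: tree_blocks_def)

text \<open>The root has no certificate, and nodes below one child are certified by leaves below the
  same child, so the counts split.\<close>

lemma tree_blocks_Cons:
  assumes "decorated (Node (t # ts))"
  shows "tree_blocks (Node (t # ts)) = tree_blocks (Node [t]) @ tree_blocks (Node ts)"
proof -
  let ?n = "length (leaves t)"
  have t: "decorated_at 1 t" and ts: "\<forall>t \<in> set ts. decorated_at 1 t"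
    using assms by (auto simp: decorated_iff)
  have "cert_count (Node (t # ts)) i = cert_count (Node [t]) i" if "i < ?n" for i
    using cert_from_support(2)[OF ts, of ?n i] that by (auto simp: cert_count_Node)
  then have "blocks (cert_count (Node (t # ts))) 0 (add_up (leaf_ups t)) =
    blocks (cert_count (Node [t])) 0 (add_up (leaf_ups t))"
    by (intro blocks_cong) (simp add: length_leaf_ups length_add_up)
  moreover have "cert_count (Node (t # ts)) (?n + i) = cert_count (Node ts) i" for i
    using cert_from_support(1)[OF t, of 0 "?n + i"] cert_from_shift(2)[of 1 0 ?n ts i]
    by (auto simp: cert_count_Node add.commute)
  then have "blocks (cert_count (Node (t # ts))) ?n (leaf_ups (Node ts)) =
    blocks (cert_count (Node ts)) 0 (leaf_ups (Node ts))"
    by (intro blocks_cong) simp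
  ultimately show ?thesis
    by (simp add: tree_blocks_def blocks_append length_leaf_ups length_add_up)
qed

text \<open>The contacts of the path are exactly the ends of the blocks of free leaves.\<close>

inductive free_contacts :: "(bool \<times> step list) list \<Rightarrow> bool" where
  Nil: "free_contacts []"
| Cons: "\<forall>x \<in> set xs. \<not> fst x \<Longrightarrow> dyck D \<Longrightarrow> word xs @ b = Up # D @ [Down] \<Longrightarrow>
    free_contacts zs \<Longrightarrow> free_contacts (xs @ (True, b) # zs)"

lemma free_contacts_append:
  assumes "free_contacts zs" "free_contacts zs'"
  shows "free_contacts (zs @ zs')"
  using assms by (induction rule: free_contacts.induct) (auto intro: free_contacts.intros)

text \<open>Each group of blocks closed by a free one spells a Dyck path that returns to height 0
  only at its end, hence has exactly one contact.\<close>

lemma free_contacts_dyck: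
  assumes "free_contacts zs"
  shows "dyck (word zs)" "contacts (word zs) = count_list (map fst zs) True"
  using assms
proof (induction rule: free_contacts.induct)
  case (Cons xs D b zs)
  have w: "word (xs @ (True, b) # zs) = (Up # D @ [Down]) @ word zs"
    using Cons(3) by simp
  have "count_list (map fst xs) True = 0"
    using Cons(1) by (auto simp: count_list_0_iff)
  { case 1 show ?case unfolding w using Cons dyck_Up_Down dyck_append by blast }
  { case 2 show ?case
      unfolding w contacts_append[OF dyck_Up_Down[OF Cons(2)]] contacts_Up_Down[OF Cons(2)]
      using Cons(6) \<open>count_list (map fst xs) True = 0\<close> by simp }
qed simp_all

text \<open>Every free block ends at a contact, so cutting after any of them, not only the first,
  leaves Dyck paths on both sides.\<close>

lemma free_contacts_split:
  assumes "free_contacts (xs @ (True, b) # zs)"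
  shows "dyck (word xs @ b) \<and> word xs @ b \<noteq> [] \<and> free_contacts zs"
  using assms
proof (induction "xs @ (True, b) # zs" arbitrary: xs rule: free_contacts.induct)
  case (Cons us D b' zs')
  \<comment> \<open>The chosen free block closes the first group, lies in a later group, or precedes
    the end of the first group; the last is impossible, as those blocks are not free.\<close>
  from Cons(6) consider (here) "us = xs" "b' = b" "zs' = zs"
    | (later) xs' where "xs = us @ (True, b') # xs'" "zs' = xs' @ (True, b) # zs"
    | (before) "(True, b) \<in> set us"
    by (auto simp: append_eq_append_conv2 Cons_eq_append_conv append_eq_Cons_conv)
  then show ?case
  proof cases
    case here
    then show ?thesis using Cons(2-4) dyck_Up_Down by auto
  next
    case later
    then have IH: "dyck (word xs' @ b)" "free_contacts zs" using Cons(5) by auto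
    have "word xs @ b = (Up # D @ [Down]) @ word xs' @ b"
      using Cons(3) later by (metis append.assoc word_simps(2,3) snd_conv)
    then show ?thesis
      using IH dyck_append[OF dyck_Up_Down[OF Cons(2)] IH(1)] by simp
  qed (use Cons(1) in auto)
qed simp

lemma map_fst_blocks: "map fst (blocks c k xs) = map (\<lambda>x. fst x = -1) xs"
  by (induction c k xs rule: blocks.induct) auto

lemma count_tree_blocks: "count_list (map fst (tree_blocks T)) True = fl T"
proof -
  have "count_list (map (\<lambda>a. a = -1) as) True = count_list as (-1)" for as :: "int list"
    by (induction as) auto
  from this[of "leaves T"] show ?thesis
    by (simp add: tree_blocks_def map_fst_blocks fl_def comp_def flip: map_fst_leaf_ups)
qed

text \<open>The child of the root of \<open>T\<close> is certified by the first free leaf, which is also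
  free in \<open>\<Pi>\<^sub>T T\<close>; hence the extra down step is inserted at a contact. By condition (3) no
  label 0 follows that leaf, so the free leaves after it are the same in both trees.\<close>

lemma lift_blocks:
  assumes T: "decorated (Node [t])" "\<not> is_Leaf t"
    and IH: "free_contacts (tree_blocks (map_ptree decr_label t))"
  shows "\<exists>A B. dyck A \<and> dyck B \<and> A \<noteq> [] \<and> word (tree_blocks (map_ptree decr_label t)) = A @ B \<and>
    word (tree_blocks (Node [t])) = Up # A @ Down # B \<and> free_contacts (tree_blocks (Node [t]))"
proof -
  define T' where "T' = map_ptree decr_label t"
  define c where "c = cert_from 1 0 t"
  define c' where "c' = cert_count T'"
  have lab: "\<forall>a \<in> set (leaves t). -1 \<le> a" and at: "decorated_at 1 t"
    and root: "decorated_node 0 [t]"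
    using T by (auto simp: decorated_iff)
  \<comment> \<open>Condition (2) for \<open>t\<close> at depth 1 gives a label at most -1.\<close>
  have "\<exists>a \<in> set (leaves t). a \<le> -1"
    using at T(2) by (cases t) (auto simp: decorated_node_def)
  then have "-1 \<in> set (map fst (leaf_ups t))"
    using lab unfolding map_fst_leaf_ups by force
  then have "\<exists>x \<in> set (leaf_ups t). fst x = -1" by force
  from split_list_first_prop[OF this] obtain xs x ys
    where xs: "leaf_ups t = xs @ x # ys" "fst x = -1" "\<forall>y \<in> set xs. fst y \<noteq> -1" by blast
  obtain n where x: "x = (-1, n)" using xs(2) by (cases x) auto
  have lv: "leaves t = map fst xs @ -1 # map fst ys"
    using xs x by (simp flip: map_fst_leaf_ups)
  \<comment> \<open>\<open>decr_label\<close> would make a label 0 free; condition (3) at the root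
    excludes it after a leaf labeled -1.\<close>
  have no0: "\<forall>y \<in> set ys. fst y \<noteq> 0"
  proof (intro ballI notI)
    fix y assume y: "y \<in> set ys"
    assume "fst y = 0"
    then obtain i where i: "i < length ys" "fst (ys ! i) = 0"
      using y by (auto simp: in_set_conv_nth)
    then have "leaves t ! (length xs + Suc i) = 0" "length xs + Suc i < length (leaves t)"
      by (simp_all add: lv nth_append)
    then have "0 \<le> leaves t ! length xs"
      using root unfolding decorated_node_def by fastforce
    then show False by (simp add: lv nth_append)
  qed
  have "takeWhile (\<lambda>a. a \<noteq> -1) (leaves t) = map fst xs"
    using xs(3) unfolding lv by (subst takeWhile_append2) auto
  then have c: "c l = c' l + (if l = length xs then 1 else 0)" for l
    using cert_from_root_child[OF lab T(2), of l] by (simp add: c_def c'_def T'_def)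
  define zs where "zs = blocks c (Suc (length xs)) ys"
  define b where "b = replicate n Up @ replicate (Suc (c' (length xs))) Down"
  \<comment> \<open>Leaves in \<open>xs\<close> labeled 0 become free in \<open>T'\<close>, so
    \<open>ws\<close> may contain free blocks although none of these leaves is free in
    \<open>t\<close>.\<close>
  define ws where "ws = blocks c' 0 (map (apfst decr_label) xs)"
  have zs: "blocks c' (Suc (length xs)) (map (apfst decr_label) ys) = zs"
  proof -
    have "blocks c' k (map (apfst decr_label) ys) = blocks c' k ys" for k
      using no0 by (induction c' k ys rule: blocks.induct) (auto simp: decr_label_def)
    then show ?thesis
      unfolding zs_def by (auto intro!: blocks_cong simp: c)
  qed
  have blT': "tree_blocks T' = ws @ (True, b) # zs"
    unfolding tree_blocks_def c'_def[symmetric] unfolding T'_def leaf_ups_map_ptree xs(1) x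
    by (simp add: blocks_append ws_def b_def zs decr_label_def)
  have ws: "word ws = word (blocks c 0 xs)"
    unfolding ws_def word_blocks_map
    by (rule arg_cong[of _ _ word]) (auto intro!: blocks_cong simp: c)
  have "cert_count (Node [t]) = c"
    by (rule ext) (simp add: cert_count_Node c_def)
  then have "tree_blocks (Node [t]) = blocks c 0 (add_up (xs @ x # ys))"
    by (simp add: tree_blocks_def xs(1))
  moreover have "\<exists>us b'. blocks c 0 (add_up (xs @ x # ys)) = us @ (True, b') # zs \<and>
    word us @ b' = Up # word ws @ b @ [Down] \<and> (\<forall>x \<in> set us. \<not> fst x)"
  \<comment> \<open>The up step above \<open>t\<close> belongs to its first leaf, which is the free
    leaf \<open>x\<close> itself when \<open>xs\<close> is empty.\<close>
  proof (cases xs rule: add_up.cases)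
    case 1
    then show ?thesis
      by (intro exI[of _ "[]"] exI[of _ "Up # b @ [Down]"])
        (simp add: x zs_def b_def ws_def c replicate_append_same)
  next
    case (2 a m xs')
    let ?us = "blocks c 0 (add_up xs)"
    let ?b = "replicate n Up @ replicate (Suc (c (length xs))) Down"
    have "add_up (xs @ x # ys) = add_up xs @ x # ys" using 2 by simp
    moreover have "length (add_up xs) = length xs" by (rule length_add_up)
    moreover have "word ?us = Up # word ws" using 2 by (simp add: word_blocks_add_up ws)
    \<comment> \<open>The first free leaf certifies one node more than in \<open>T'\<close>, namely
      \<open>t\<close>.\<close>
    moreover have "?b = b @ [Down]"
      by (simp add: b_def c replicate_append_same)
    moreover have "fst ` set ?us = set (map fst ?us)" by simp
    then have "\<forall>x \<in> set ?us. \<not> fst x"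
      using xs(3) 2 unfolding map_fst_blocks by force
    ultimately show ?thesis
      by (intro exI[of _ ?us] exI[of _ ?b]) (simp add: blocks_append x zs_def)
  qed
  ultimately obtain us b' where us: "tree_blocks (Node [t]) = us @ (True, b') # zs"
    "word us @ b' = Up # word ws @ b @ [Down]" "\<forall>x \<in> set us. \<not> fst x" by auto
  from free_contacts_split[of ws b zs] IH
  have A: "dyck (word ws @ b)" "word ws @ b \<noteq> []" and zs: "free_contacts zs"
    by (simp_all add: blT' flip: T'_def)
  \<comment> \<open>Elevation by the new up step removes the contacts inside
    \<open>word ws @ b\<close>, in accordance with the leaves of \<open>us\<close> not being
    free.\<close>
  have "free_contacts (tree_blocks (Node [t]))"
    unfolding us(1) using us A zs by (intro free_contacts.Cons[of _ "word ws @ b"]) auto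
  moreover have "word (tree_blocks (Node [t])) = Up # (word ws @ b) @ Down # word zs"
    using us(1,2) by (metis Cons_eq_appendI append_assoc append_Nil snd_conv word_simps(2,3))
  ultimately show ?thesis
    using A free_contacts_dyck(1)[OF zs] by (intro exI[of _ "word ws @ b"] exI[of _ "word zs"])
      (simp add: blT' flip: T'_def)
qed

text \<open>Condition (1) at depth 0 leaves -1 as the only label, and there is no non-root internal
  node to be certified.\<close>

lemma tree_blocks_Leaf:
  assumes "decorated (Node [Leaf a])"
  shows "tree_blocks (Node [Leaf a]) = [(True, [Up, Down])]"
  using assms by (auto simp: tree_blocks_def decorated_iff decorated_node_def cert_count_Node)


section \<open>Synchronized intervals\<close>

lemma Q_path_map_ptree: "Q_path (map_ptree f t) = Q_path t"
  by (induction t) (simp_all add: comp_def cong: map_cong)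

lemma dyck_Q_path: "dyck (Q_path t)"
proof (induction t)
  case (Node ts)
  then show ?case
  proof (induction ts)
    case (Cons t ts)
    then have "dyck ((Up # Q_path t @ [Down]) @ Q_path (Node ts))"
      by (intro dyck_append dyck_Up_Down) auto
    then show ?case by simp
  qed simp
qed simp

text \<open>The induction hypothesis. It also holds for \<open>Node []\<close>, and it uses
  \<open>up_letters\<close> in place of \<open>dyck_type\<close> because \<open>butlast\<close> does
  not commute with concatenation. Dyckness and contacts of the lower path come from
  \<open>free_contacts\<close>.\<close>

definition sync :: "int ptree \<Rightarrow> bool" where
  "sync T \<longleftrightarrow> free_contacts (tree_blocks T) \<and> length (P_path T) = length (Q_path T) \<and>
     tamari_le (P_path T) (Q_path T) \<and> up_letters (P_path T) = up_letters (Q_path T)"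

lemma P_path_Nil [simp]: "P_path (Node []) = []"
  by (simp add: P_path_def)

lemma P_path_Cons:
  assumes "decorated (Node (t # ts))"
  shows "P_path (Node (t # ts)) = P_path (Node [t]) @ P_path (Node ts)"
  using assms P_path_blocks[OF assms] P_path_blocks[OF decorated_head[OF assms]]
    P_path_blocks[OF decorated_tail[OF assms]] tree_blocks_Cons[OF assms]
  by (cases "ts = []") auto

lemma sync_Nil: "sync (Node [])"
  by (simp add: sync_def free_contacts.Nil tamari_le_refl)

lemma sync_Cons:
  assumes "decorated (Node (t # ts))" "sync (Node [t])" "sync (Node ts)"
  shows "sync (Node (t # ts))"
proof -
  have "dyck (P_path (Node [t]))"
    using P_path_blocks[OF decorated_head[OF assms(1)]] assms(2) free_contacts_dyck(1)
    by (auto simp: sync_def)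
  moreover have "dyck (P_path (Node ts))"
    using P_path_blocks[OF decorated_tail[OF assms(1)]] assms(3) free_contacts_dyck(1)
    by (cases "ts = []") (auto simp: sync_def)
  moreover have "Q_path (Node (t # ts)) = Q_path (Node [t]) @ Q_path (Node ts)" by simp
  ultimately show ?thesis
    using assms(2,3) dyck_Q_path[of "Node [t]"] tree_blocks_Cons[OF assms(1)]
    unfolding sync_def P_path_Cons[OF assms(1)]
    by (simp only: free_contacts_append tamari_le_append up_letters_dyck_append length_append)
qed

lemma sync_Leaf:
  assumes "decorated (Node [Leaf a])"
  shows "P_path (Node [Leaf a]) = [Up, Down]" "sync (Node [Leaf a])"
proof -
  show P: "P_path (Node [Leaf a]) = [Up, Down]"
    by (simp add: P_path_blocks[OF assms] tree_blocks_Leaf[OF assms])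
  have "free_contacts [(True, [Up, Down])]"
    using free_contacts.Cons[of "[]" "[]" "[Up, Down]" "[]"] free_contacts.Nil by simp
  then show "sync (Node [Leaf a])"
    by (simp add: sync_def P tree_blocks_Leaf[OF assms] tamari_le_refl)
qed

text \<open>The elevated part \<open>u A d\<close> has one contact, and the contacts of the whole
  path count the free leaves, which yields \<open>1 + contacts B\<close>.\<close>

lemma lift_path:
  assumes T: "decorated (Node [t])" "\<not> is_Leaf t" and IH: "sync (map_ptree decr_label t)"
  obtains A B where "dyck A" "dyck B" "P_path (map_ptree decr_label t) = A @ B"
    "P_path (Node [t]) = Up # A @ Down # B" "1 + contacts B = fl (Node [t])" "sync (Node [t])"
proof -
  let ?T' = "map_ptree decr_label t"
  obtain A B where AB: "dyck A" "dyck B" "A \<noteq> []" "word (tree_blocks ?T') = A @ B"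
    "word (tree_blocks (Node [t])) = Up # A @ Down # B" "free_contacts (tree_blocks (Node [t]))"
    using lift_blocks[OF T] IH by (auto simp: sync_def)
  note P = AB(5)[folded P_path_blocks[OF T(1)]]
  note P' = AB(4)[folded P_path_blocks[OF decorated_Pi_T[OF T]]]
  have Q: "Q_path (Node [t]) = Up # Q_path t @ [Down]" by simp
  have "contacts ((Up # A @ [Down]) @ B) = 1 + contacts B"
    unfolding contacts_append[OF dyck_Up_Down[OF AB(1)]] contacts_Up_Down[OF AB(1)] ..
  then have cont: "1 + contacts B = fl (Node [t])"
    using free_contacts_dyck(2)[OF AB(6)] AB(5) by (simp add: count_tree_blocks)
  have QAB: "length (A @ B) = length (Q_path t)" "tamari_le (A @ B) (Q_path t)"
    "up_letters (A @ B) = up_letters (Q_path t)"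
    using IH P' by (simp_all add: sync_def Q_path_map_ptree)
  have "Q_path t \<noteq> []" using QAB(1) AB(3) by auto
  then have "sync (Node [t])"
    unfolding sync_def P Q up_letters_Up_dyck[OF AB(1,3)]
    using QAB tamari_le_Up_Down[OF AB(1,2) QAB(2)] AB(6)
      up_letters_Up_dyck[OF dyck_Q_path[of t], of "[]"] by simp
  with that[OF AB(1,2) P' P cont] show thesis .
qed

lemma decorated_sync: "decorated T \<Longrightarrow> sync T"
\<comment> \<open>The reduced tree is not a subterm, but relabeling preserves size, so it is
  smaller.\<close>
proof (induction T rule: measure_induct_rule[of size])
  case (less T)
  then obtain ts where T: "T = Node ts" by (cases T) (auto simp: decorated_iff)
  then obtain t us where ts: "ts = t # us"
    using less.prems by (cases ts) (auto simp: decorated_iff decorated_node_def)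
  note d = less.prems[unfolded T ts]
  have "sync (Node [t])"
  proof (cases "is_Leaf t")
    case True
    then show ?thesis using sync_Leaf(2) decorated_head[OF d] by (cases t) auto
  next
    case False
    have "sync (map_ptree decr_label t)"
      using less.IH decorated_Pi_T[OF decorated_head[OF d] False]
      by (simp add: T ts size_map_ptree)
    then show ?thesis using lift_path[OF decorated_head[OF d] False] by blast
  qed
  moreover have "sync (Node us)"
    using less.IH[of "Node us"] decorated_tail[OF d] sync_Nil by (cases "us = []") (auto simp: T ts)
  ultimately show ?case using sync_Cons[OF d] by (simp add: T ts)
qed

section \<open>The interval of a decorated tree and the recursion of \<open>phi_I\<close> on
  it\<close>

lemma dyck_P_path: "decorated T \<Longrightarrow> dyck (P_path T)"
  using decorated_sync free_contacts_dyck(1) P_path_blocks by (auto simp: sync_def)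

lemma length_P_path: "decorated T \<Longrightarrow> length (P_path T) = length (Q_path T)"
  using decorated_sync by (simp add: sync_def)

lemma Q_path_nonempty: "decorated T \<Longrightarrow> Q_path T \<noteq> []"
  by (cases T rule: Q_path.cases) (auto simp: decorated_iff decorated_node_def neq_Nil_conv)

lemma sync_interval_I_map: "decorated T \<Longrightarrow> sync_interval (P_path T, Q_path T)"
  using decorated_sync[of T] dyck_P_path[of T] dyck_Q_path[of T] Q_path_nonempty[of T]
  by (auto simp: sync_interval_def sync_def dyck_type_def)

text \<open>One unfolding of \<open>phi_I\<close>: the first return of \<open>P\<close> isolates
  \<open>A\<close>, and the length condition singles out \<open>B\<close> as the prefix of the
  remainder that completes \<open>A\<close> to the size of \<open>Q1\<close>.\<close>

lemma phi_I_decompose: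
  assumes "sync_interval (P, Q)" "P = Up # A @ Down # B @ P2" "Q = Up # Q1 @ Down # Q2"
    "dyck A" "dyck B" "dyck P2" "dyck Q1" "dyck Q2" "length (A @ B) = length Q1"
  shows "phi_I (P, Q) =
    (if Q1 = [] \<and> Q2 = [] then B0
     else if Q2 = [] then Delta_B (phi_I (A @ B, Q1)) (contacts P)
     else if Q1 = [] then L_B (phi_I (P2, Q2))
     else oplus_B (phi_I (A @ B, Q1)) (1 + contacts B) (phi_I (P2, Q2)))"
proof -
  have "first_return Q = (Q1, Q2)"
    using first_return_eq[OF assms(7,8)] by (simp add: assms(3))
  moreover have "first_return P = (A, B @ P2)"
    using first_return_eq[OF assms(4) dyck_append[OF assms(5,6)]] by (simp add: assms(2))
  moreover have "length Q1 - length A = length B" using assms(9) by simp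
  ultimately show ?thesis
    using assms(1) by (subst phi_I.simps) (simp add: cont_def)
qed

lemma phi_I_Leaf:
  assumes "decorated (Node (Leaf a # ts))"
  shows "phi_I (I_map (Node (Leaf a # ts))) =
    (if ts = [] then B0 else L_B (phi_I (I_map (Node ts))))"
proof -
  have P: "P_path (Node (Leaf a # ts)) = Up # [] @ Down # [] @ P_path (Node ts)"
    using P_path_Cons[OF assms] sync_Leaf(1)[OF decorated_head[OF assms]] by simp
  have "dyck (P_path (Node ts))"
    using dyck_P_path decorated_tail[OF assms] by (cases "ts = []") auto
  from phi_I_decompose[OF sync_interval_I_map[OF assms] P, of "[]" "Q_path (Node ts)"]
    this dyck_Q_path[of "Node ts"]
  show ?thesis by (auto simp: I_map_def)
qed

lemma phi_I_Node:
  assumes d: "decorated (Node (t # ts))" and t: "\<not> is_Leaf t"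
  shows "phi_I (I_map (Node (t # ts))) =
    (if ts = [] then Delta_B (phi_I (I_map (map_ptree decr_label t))) (fl (Node [t]))
     else oplus_B (phi_I (I_map (map_ptree decr_label t))) (fl (Node [t])) (phi_I (I_map (Node ts))))"
proof -
  let ?T' = "map_ptree decr_label t"
  note d1 = decorated_head[OF d]
  note d' = decorated_Pi_T[OF d1 t]
  obtain A B where AB: "dyck A" "dyck B" "P_path ?T' = A @ B"
    "P_path (Node [t]) = Up # A @ Down # B" "1 + contacts B = fl (Node [t])"
    using lift_path[OF d1 t decorated_sync[OF d']] by blast
  have P: "P_path (Node (t # ts)) = Up # A @ Down # B @ P_path (Node ts)"
    using P_path_Cons[OF d] AB(4) by simp
  have Q: "Q_path (Node (t # ts)) = Up # Q_path ?T' @ Down # Q_path (Node ts)"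
    by (simp add: Q_path_map_ptree)
  have P2: "dyck (P_path (Node ts))"
    using dyck_P_path decorated_tail[OF d] by (cases "ts = []") auto
  have len: "length (A @ B) = length (Q_path ?T')"
    using length_P_path[OF d'] AB(3) by simp
  \<comment> \<open>Without further children the label of \<open>Delta_B\<close> is the number of
    contacts of the whole path, hence of free leaves.\<close>
  have c: "contacts (P_path (Node (t # ts))) = fl (Node [t])" if "ts = []"
    using that free_contacts_dyck(2) decorated_sync[OF d1]
    by (simp add: sync_def P_path_blocks[OF d1] count_tree_blocks)
  \<comment> \<open>Since \<open>Q_path ?T'\<close> is nonempty, only the \<open>Delta_B\<close> and
    \<open>oplus_B\<close> branches remain.\<close>
  show ?thesis
    using phi_I_decompose[OF sync_interval_I_map[OF d] P Q AB(1,2) P2 dyck_Q_path dyck_Q_path len]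
      Q_path_nonempty[OF d'] Q_path_nonempty[OF decorated_tail[OF d]] AB(3,5) c
    by (cases "ts = []") (auto simp: I_map_def)
qed

theorem theorem3p7:
  fixes T :: "int ptree"
  assumes "decorated T"
  shows "phi_T T = phi_I (I_map T)"
  using assms
proof (induction T rule: phi_T.induct)
  case (1 a)
  then show ?case by (simp add: phi_I_Leaf)
next
  case (2 ts)
  then show ?case
    using decorated_Pi_T[of "Node ts"] phi_I_Node[of "Node ts" "[]"] by simp
next
  case (3 a t ts)
  then show ?case
    using phi_I_Leaf[of a "t # ts"] decorated_tail[of "Leaf a" "t # ts"] by simp
next
  case ("4_1" us t ts)
  then show ?case
    using phi_I_Node[of "Node us" "t # ts"] decorated_tail[of "Node us" "t # ts"]
      decorated_Pi_T[of "Node us"] decorated_head[of "Node us" "t # ts"] by simp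
next
  case ("4_2" us t ts)
  then show ?case
    using phi_I_Node[of "Node us" "t # ts"] decorated_tail[of "Node us" "t # ts"]
      decorated_Pi_T[of "Node us"] decorated_head[of "Node us" "t # ts"] by simp
qed (auto simp: decorated_iff decorated_node_def)

end
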